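(* Let $L:\mathbb R\to(-\infty,+\infty]$ and let $c:\mathbb R^d\times\mathbb R^d\to[0,+\infty]$ be a transportation cost function with $c(z,\hat z)=0$ if and only if $z=\hat z$. For $\theta\in\mathbb R^d$, $\lambda\ge0$ and $\hat z\in\mathbb R^d$ define $$\ell_c(\theta,\lambda,\hat z)=\sup_{z\in\mathrm{dom}(c(\cdot,\hat z))}L(\langle\theta,z\rangle)-\lambda c(z,\hat z).$$ (i) If $L$ is proper, convex and lower semicontinuous, and $c$ is proper and lower semicontinuous, then $$\ell_c(\theta,\lambda,\hat z)=\sup_{\gamma\in\mathrm{dom}(L^* )}\lambda\,c^{*1}(\gamma\theta/\lambda,\hat z)-L^*(\gamma),$$ and this is convex in $(\theta,\lambda)$ for any $\hat z$. (ii) If $c(z,\hat z)=\|z-\hat z\|^p$ for a norm $\|\cdot\|$ on $\mathbb R^d$ and $p\ge1$, then $$\ell_c(\theta,\lambda,\hat z)=\sup_{\gamma\in\mathbb R}L\big(\langle\theta,\hat z\rangle+\gamma\|\theta\|_*\big)-\lambda|\gamma|^p.$$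
   Context: $\mathrm{dom}(f)=\{x:f(x)<\infty\}$; $f^*(y)=\sup_x\langle y,x\rangle-f(x)$ is the convex conjugate; $c^{*1}(\cdot,\hat z)$ is the conjugate of $c(\cdot,\hat z)$ for fixed $\hat z$. $\|y\|_*=\sup\{\langle x,y\rangle:\|x\|\le1\}$ is the dual norm. Perspective convention: for a proper, convex, lower semicontinuous function $f$ and $\lambda\ge0$, $\lambda f(x/\lambda)$ denotes the perspective function, which has its usual meaning for $\lambda>0$ and equals $\delta^*_{\mathrm{dom}(f^* )}(x)=\sup_{y\in\mathrm{dom}(f^* )}\langle x,y\rangle$ for $\lambda=0$; this applies to $\lambda c^{*1}(\gamma\theta/\lambda,\hat z)$. *)

theory Defs
  imports "HOL-Analysis.Analysis"
begin

definition edom :: "('a \<Rightarrow> ereal) \<Rightarrow> 'a set" where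
  "edom f = {x. f x < \<infinity>}"

definition proper_fun :: "('a \<Rightarrow> ereal) \<Rightarrow> bool" where
  "proper_fun f \<longleftrightarrow> (\<forall>x. f x \<noteq> -\<infinity>) \<and> (\<exists>x. f x \<noteq> \<infinity>)"

definition lsc_fun :: "('a::topological_space \<Rightarrow> ereal) \<Rightarrow> bool" where
  "lsc_fun f \<longleftrightarrow> (\<forall>x. f x \<le> Liminf (at x) f)"

text \<open>Meant for functions that do not take the value \<open>-\<infinity>\<close>, so that the right-hand side
  contains no difference of infinities. The end points \<open>u = 0\<close> and \<open>v = 0\<close> are harmless
  because \<open>0 * \<infinity> = 0\<close> in \<^typ>\<open>ereal\<close>.\<close>

definition econvex_on :: "'a::real_vector set \<Rightarrow> ('a \<Rightarrow> ereal) \<Rightarrow> bool" where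
  "econvex_on S f \<longleftrightarrow> convex S \<and>
     (\<forall>x\<in>S. \<forall>y\<in>S. \<forall>u\<ge>0. \<forall>v\<ge>0. u + v = 1 \<longrightarrow>
        f (u *\<^sub>R x + v *\<^sub>R y) \<le> ereal u * f x + ereal v * f y)"

definition fconj :: "('a::real_inner \<Rightarrow> ereal) \<Rightarrow> 'a \<Rightarrow> ereal" where
  "fconj f y = (SUP x. ereal (y \<bullet> x) - f x)"

text \<open>\<open>perspective f l x\<close> is \<open>l f(x/l)\<close>; at \<open>l = 0\<close> it is the support function of the
  domain of the conjugate of \<open>f\<close>. It is used only for \<open>l \<ge> 0\<close>.\<close>

definition perspective :: "('a::real_inner \<Rightarrow> ereal) \<Rightarrow> real \<Rightarrow> 'a \<Rightarrow> ereal" where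
  "perspective f l x =
     (if l = 0 then (SUP y\<in>edom (fconj f). ereal (x \<bullet> y)) else ereal l * f (x /\<^sub>R l))"

text \<open>Nonnegativity follows from the other clauses.\<close>

definition is_norm :: "('a::real_vector \<Rightarrow> real) \<Rightarrow> bool" where
  "is_norm N \<longleftrightarrow> (\<forall>x. N x = 0 \<longleftrightarrow> x = 0) \<and> (\<forall>a x. N (a *\<^sub>R x) = \<bar>a\<bar> * N x) \<and>
     (\<forall>x y. N (x + y) \<le> N x + N y)"

definition dual_norm :: "('a::real_inner \<Rightarrow> real) \<Rightarrow> 'a \<Rightarrow> real" where
  "dual_norm N y = (SUP x\<in>{x. N x \<le> 1}. x \<bullet> y)"

definition ell ::
  "(real \<Rightarrow> ereal) \<Rightarrow> ('a::real_inner \<Rightarrow> 'a \<Rightarrow> ereal) \<Rightarrow> 'a \<Rightarrow> real \<Rightarrow> 'a \<Rightarrow> ereal" where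
  "ell L c \<theta> l zh = (SUP z\<in>edom (\<lambda>z. c z zh). L (\<theta> \<bullet> z) - ereal l * c z zh)"

end

theory Submission
  imports Defs
begin

text \<open>For part (i), write \<open>L\<close> as its biconjugate and exchange the two suprema; convexity holds because
  \<open>L(\<langle>\<theta>, z\<rangle>) - \<lambda> c(z, zh)\<close> is convex in \<open>(\<theta>, \<lambda>)\<close> for each fixed \<open>z\<close>. For \<open>\<lambda> = 0\<close> the exchange
  needs that \<open>c(\<cdot>, zh)\<close> and its biconjugate have domains with the same support function.
  For part (ii), \<open>\<langle>\<theta>, w\<rangle>\<close> ranges over \<open>[-r \<parallel>\<theta>\<parallel>\<^sub>*, r \<parallel>\<theta>\<parallel>\<^sub>*]\<close> on the ball \<open>\<parallel>w\<parallel> \<le> r\<close>, since the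
  supremum defining the dual norm is attained.\<close>

section \<open>Epigraphs and affine minorants\<close>

text \<open>If the limit \<open>(x, t)\<close> had \<open>t < f x\<close>, a level \<open>s\<close>
  strictly between would lie below \<open>f\<close> near \<open>x\<close>, yet above the second
  components eventually. Closedness is what the separation theorem requires.\<close>

lemma lsc_fun_closed_epigraph:
  fixes f :: "'a::metric_space \<Rightarrow> ereal"
  assumes "lsc_fun f"
  shows "closed {(x, t). f x \<le> ereal t}"
proof (unfold closed_sequential_limits, intro allI impI, elim conjE)
  fix X :: "nat \<Rightarrow> 'a \<times> real" and l
  assume X: "\<forall>n. X n \<in> {(x, t). f x \<le> ereal t}" and lim: "X \<longlonglongrightarrow> l"
  obtain x t where l: "l = (x, t)" by (cases l)
  have xl: "(\<lambda>n. fst (X n)) \<longlonglongrightarrow> x" and tl: "(\<lambda>n. snd (X n)) \<longlonglongrightarrow> t"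
    using tendsto_fst[OF lim] tendsto_snd[OF lim] l by auto
  have "f x \<le> ereal t"
  proof (rule ccontr)
    assume "\<not> f x \<le> ereal t"
    then obtain s where s: "ereal t < ereal s" "ereal s < f x"
      by (metis ereal_dense2 linorder_not_le)
    have "f x \<le> Liminf (at x) f" using assms by (simp add: lsc_fun_def)
    then have "\<forall>\<^sub>F y in at x. ereal s < f y"
      using s(2) by (simp add: le_Liminf_iff)
    \<comment> \<open>The filter \<open>at x\<close> omits \<open>x\<close> itself;
      \<open>s < f x\<close> fills the gap, so the sequence may also take the value
      \<open>x\<close>.\<close>
    then have "\<forall>\<^sub>F y in nhds x. ereal s < f y"
      using s(2) by (auto simp: eventually_at_filter elim: eventually_mono)
    then have "\<forall>\<^sub>F n in sequentially. ereal s < f (fst (X n))"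
      using xl by (auto simp: filterlim_iff)
    moreover have "\<forall>\<^sub>F n in sequentially. snd (X n) < s"
      using tl s(1) by (auto intro: order_tendstoD)
    ultimately have "\<forall>\<^sub>F n in sequentially. False"
    proof eventually_elim
      case (elim n)
      have "f (fst (X n)) \<le> ereal (snd (X n))" using X by (auto simp: case_prod_beta)
      also have "\<dots> < ereal s" using elim by simp
      finally show False using elim by (metis less_asym)
    qed
    then show False by simp
  qed
  then show "l \<in> {(x, t). f x \<le> ereal t}" by (simp add: l)
qed

lemma econvex_on_convex_epigraph:
  assumes "econvex_on UNIV f"
  shows "convex {(x, t). f x \<le> ereal t}"
proof (rule convexI, clarsimp)
  fix x s y t and u v :: real
  assume *: "f x \<le> ereal s" "f y \<le> ereal t" "0 \<le> u" "0 \<le> v" "u + v = 1"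
  have "f (u *\<^sub>R x + v *\<^sub>R y) \<le> ereal u * f x + ereal v * f y"
    using assms * by (auto simp: econvex_on_def)
  also have "\<dots> \<le> ereal u * ereal s + ereal v * ereal t"
    using * by (intro add_mono ereal_mult_left_mono) auto
  finally show "f (u *\<^sub>R x + v *\<^sub>R y) \<le> ereal (u * s + v * t)" by simp
qed

text \<open>Separate \<open>(x0, a)\<close> from the closed convex epigraph. A non-vertical
  hyperplane is the graph of the desired minorant; a vertical one, possible only for
  \<open>x0\<close> outside the domain, has to be combined with a non-vertical one.\<close>

lemma affine_minorant:
  fixes f :: "'a::euclidean_space \<Rightarrow> ereal"
  assumes "proper_fun f" "econvex_on UNIV f" "lsc_fun f" and a: "ereal a < f x0"
  obtains y b where "\<And>x. ereal (y \<bullet> x + b) \<le> f x" "a \<le> y \<bullet> x0 + b"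
proof -
  let ?E = "{(x, t). f x \<le> ereal t}"
  have sep: "\<exists>p q b. 0 \<le> q \<and> p \<bullet> x0 + q * a < b \<and> (\<forall>x t. f x \<le> ereal t \<longrightarrow> b < p \<bullet> x + q * t)"
    if "ereal a < f x0" for a x0
  proof -
    have "\<exists>w b. w \<bullet> (x0, a) < b \<and> (\<forall>e\<in>?E. b < w \<bullet> e)"
      using that lsc_fun_closed_epigraph[OF assms(3)] econvex_on_convex_epigraph[OF assms(2)]
      by (intro separating_hyperplane_closed_point) auto
    then obtain p q b where pq: "p \<bullet> x0 + q * a < b"
      "\<And>x t. f x \<le> ereal t \<Longrightarrow> b < p \<bullet> x + q * t"
      by (force simp: inner_prod_def)
    obtain x1 t1 where x1: "f x1 = ereal t1"
      using assms(1) unfolding proper_fun_def by (metis ereal_cases)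
    \<comment> \<open>The epigraph contains the upward ray over \<open>x1\<close>, along which a
      negative \<open>q\<close> would drive the linear form below \<open>b\<close>; \<open>t\<close>
      is taken far enough up that ray.\<close>
    have "0 \<le> q"
    proof (rule ccontr)
      assume "\<not> 0 \<le> q"
      then have q: "q < 0" by simp
      define t where "t = max t1 ((b - p \<bullet> x1) / q)"
      have "f x1 \<le> ereal t" by (simp add: x1 t_def)
      from pq(2)[OF this] have "b - p \<bullet> x1 < q * t" by simp
      moreover have "q * t \<le> q * ((b - p \<bullet> x1) / q)"
        using q by (intro mult_left_mono_neg) (auto simp: t_def)
      ultimately show False using q by simp
    qed
    then show ?thesis using pq by blast
  qed
  have minorant: "ereal (((-1/q) *\<^sub>R p) \<bullet> x + b / q) \<le> f x"
    if "0 < q" "\<And>x t. f x \<le> ereal t \<Longrightarrow> b < p \<bullet> x + q * t" for p q b x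
  proof (cases "f x")
    case (real r)
    then have "b < p \<bullet> x + q * r" using that by simp
    then have "- (p \<bullet> x) / q + b / q \<le> r" using that(1) by (simp add: field_simps)
    then show ?thesis using real by simp
  qed (use assms(1) in \<open>auto simp: proper_fun_def\<close>)
  obtain p q b where pqb: "0 \<le> q" "p \<bullet> x0 + q * a < b"
      "\<And>x t. f x \<le> ereal t \<Longrightarrow> b < p \<bullet> x + q * t"
    using sep[OF a] by blast
  show thesis
  proof (cases "q = 0")
    case False
    with pqb have q: "0 < q" by simp
    show thesis
    proof (rule that)
      show "ereal (((-1/q) *\<^sub>R p) \<bullet> x + b / q) \<le> f x" for x
        using minorant[OF q pqb(3)] .
      show "a \<le> ((-1/q) *\<^sub>R p) \<bullet> x0 + b / q"
        using pqb(2) q by (simp add: field_simps)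
    qed
  next
    case True
    obtain x1 t1 where x1: "f x1 = ereal t1"
      using assms(1) unfolding proper_fun_def by (metis ereal_cases)
    \<comment> \<open>Below a point of the domain separation is never vertical:
      \<open>(x1, t1)\<close> and \<open>(x1, t1 - 1)\<close> lie strictly on opposite sides and
      differ only in height.\<close>
    obtain p' q' b' where pqb': "0 \<le> q'" "p' \<bullet> x1 + q' * (t1 - 1) < b'"
        "\<And>x t. f x \<le> ereal t \<Longrightarrow> b' < p' \<bullet> x + q' * t"
      using sep[of "t1 - 1" x1] x1 by auto
    have q': "0 < q'"
      using pqb'(1,2) pqb'(3)[of x1 t1] x1 by (cases "q' = 0") auto
    define y where "y = (-1/q') *\<^sub>R p'"
    define d where "d = b' / q'"
    have min: "ereal (y \<bullet> x + d) \<le> f x" for x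
      using minorant[OF q' pqb'(3)] by (simp add: y_def d_def)
    \<comment> \<open>The hyperplane is vertical: tilt a fixed affine minorant by a large multiple of it.\<close>
    define k where "k = max 0 ((a - (y \<bullet> x0 + d)) / (b - p \<bullet> x0))"
    have pos: "0 < b - p \<bullet> x0" using pqb(2) True by simp
    show thesis
    proof (rule that)
      show "ereal ((y - k *\<^sub>R p) \<bullet> x + (d + k * b)) \<le> f x" for x
      proof (cases "f x")
        case (real r)
        have "b < p \<bullet> x" using pqb(3)[of x r] real True by simp
        then have "k * (b - p \<bullet> x) \<le> 0" by (intro mult_nonneg_nonpos) (auto simp: k_def)
        moreover have "y \<bullet> x + d \<le> r" using min[of x] real by simp
        ultimately show ?thesis using real by (simp add: algebra_simps)
      qed (use assms(1) in \<open>auto simp: proper_fun_def\<close>)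
      have "a - (y \<bullet> x0 + d) \<le> k * (b - p \<bullet> x0)"
        using pos by (simp add: k_def pos_divide_le_eq[symmetric])
      then show "a \<le> (y - k *\<^sub>R p) \<bullet> x0 + (d + k * b)"
        by (simp add: algebra_simps)
    qed
  qed
qed

section \<open>Conjugates and biconjugates\<close>

lemma Fenchel_Young: "ereal (y \<bullet> x) - f x \<le> fconj f y"
  unfolding fconj_def by (rule SUP_upper) simp

lemma fconj_not_MInfty:
  assumes "f x \<noteq> \<infinity>"
  shows "fconj f y \<noteq> -\<infinity>"
  using Fenchel_Young[of y x f] assms by (cases "f x") auto

text \<open>An affine minorant with slope \<open>y\<close> and intercept \<open>b\<close> says
  exactly that the conjugate at \<open>y\<close> is at most \<open>-b\<close>. Minorants reaching
  any \<open>a < f x\<close> at \<open>x\<close> therefore push the supremum up to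
  \<open>f x\<close>, and their slopes lie in the domain of the conjugate.\<close>

lemma Fenchel_Moreau_le:
  fixes f :: "'a::euclidean_space \<Rightarrow> ereal"
  assumes "proper_fun f" "econvex_on UNIV f" "lsc_fun f"
  shows "f x \<le> (SUP y\<in>edom (fconj f). ereal (y \<bullet> x) - fconj f y)" (is "_ \<le> ?S")
proof (rule ccontr)
  assume "\<not> f x \<le> ?S"
  then have "?S < f x" by simp
  then obtain a where a: "?S < ereal a" "ereal a < f x"
    using ereal_dense2 by blast
  obtain y b where y: "\<And>z. ereal (y \<bullet> z + b) \<le> f z" "a \<le> y \<bullet> x + b"
    using affine_minorant[OF assms a(2)] by blast
  have le: "fconj f y \<le> ereal (-b)"
    unfolding fconj_def
  proof (rule SUP_least)
    fix z
    show "ereal (y \<bullet> z) - f z \<le> ereal (-b)"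
      using y(1)[of z] by (cases "f z") auto
  qed
  then have dom: "y \<in> edom (fconj f)" by (auto simp: edom_def)
  have "ereal a \<le> ereal (y \<bullet> x) - ereal (-b)" using y(2) by simp
  also have "\<dots> \<le> ereal (y \<bullet> x) - fconj f y" by (intro ereal_minus_mono le) simp
  also have "\<dots> \<le> ?S" by (rule SUP_upper[OF dom])
  finally show False using a(1) by simp
qed

section \<open>The perspective of a conjugate\<close>

text \<open>Brings \<open>l > 0\<close> and \<open>l = 0\<close> to a single formula. For
  \<open>l > 0\<close> the factor moves into the supremum and cancels the scaling of
  \<open>x\<close>; for \<open>l = 0\<close> the claim is that the domains of \<open>f\<close> and
  of its biconjugate have the same support function.\<close>

lemma perspective_fconj:
  fixes f :: "'a::real_inner \<Rightarrow> ereal"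
  assumes f: "\<And>z. 0 \<le> f z" and z0: "f z0 < \<infinity>" and l: "0 \<le> l"
  shows "perspective (fconj f) l x = (SUP z\<in>edom f. ereal (x \<bullet> z) - ereal l * f z)"
    (is "_ = ?S")
proof (cases "l = 0")
  case False
  with l have l: "0 < l" by simp
  have eq: "ereal l * (ereal ((x /\<^sub>R l) \<bullet> z) - f z) = ereal (x \<bullet> z) - ereal l * f z" for z
    using l f[of z] by (cases "f z") (auto simp: field_simps)
  have "perspective (fconj f) l x = ereal l * (SUP z. ereal ((x /\<^sub>R l) \<bullet> z) - f z)"
    using l by (simp add: perspective_def fconj_def)
  also have "\<dots> = (SUP z. ereal l * (ereal ((x /\<^sub>R l) \<bullet> z) - f z))"
    using l by (subst Sup_ereal_mult_left') (auto simp: image_image)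
  also have "\<dots> = (SUP z. ereal (x \<bullet> z) - ereal l * f z)"
    by (simp only: eq)
  \<comment> \<open>Points off the domain of \<open>f\<close> contribute \<open>-\<infinity>\<close>
    because \<open>l > 0\<close> here.\<close>
  also have "\<dots> = ?S"
  proof (rule antisym)
    show "(SUP z. ereal (x \<bullet> z) - ereal l * f z) \<le> ?S"
    proof (rule SUP_least)
      fix z
      show "ereal (x \<bullet> z) - ereal l * f z \<le> ?S"
      proof (cases "f z < \<infinity>")
        case True
        then show ?thesis by (intro SUP_upper) (simp add: edom_def)
      qed (use l in auto)
    qed
  qed (auto intro: SUP_subset_mono)
  finally show ?thesis .
next
  case True
  have eq: "?S = (SUP z\<in>edom f. ereal (x \<bullet> z))"
    by (simp add: True flip: zero_ereal_def)
  have "(SUP z\<in>edom (fconj (fconj f)). ereal (x \<bullet> z)) = ?S"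
  proof (rule antisym)
    show "(SUP z\<in>edom (fconj (fconj f)). ereal (x \<bullet> z)) \<le> ?S"
    proof (rule SUP_least)
      fix y assume y: "y \<in> edom (fconj (fconj f))"
      show "ereal (x \<bullet> y) \<le> ?S"
      proof (cases "?S")
        case (real b)
        have b: "x \<bullet> z \<le> b" if "f z < \<infinity>" for z
        proof -
          have "ereal (x \<bullet> z) \<le> ?S"
            unfolding eq using that by (intro SUP_upper) (simp add: edom_def)
          then show ?thesis using real by simp
        qed
        \<comment> \<open>\<open>f\<^sup>*(t x) \<le> t b\<close> for \<open>t \<ge> 0\<close>, so \<open>f\<^sup>*\<^sup>*(y) \<ge> t (x \<bullet> y - b)\<close> for all \<open>t \<ge> 0\<close>.\<close>
        have conj: "fconj f (t *\<^sub>R x) \<le> ereal (t * b)" if "0 \<le> t" for t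
          unfolding fconj_def
        proof (rule SUP_least)
          fix z
          show "ereal ((t *\<^sub>R x) \<bullet> z) - f z \<le> ereal (t * b)"
          proof (cases "f z")
            case (real r)
            have "t * (x \<bullet> z) \<le> t * b" using b[of z] real that by (intro mult_left_mono) auto
            then show ?thesis using real f[of z] by simp
          qed (use f[of z] in auto)
        qed
        \<comment> \<open>A point where the conjugate is not \<open>\<infinity>\<close> keeps the
          biconjugate away from \<open>-\<infinity>\<close>, so its value \<open>m\<close> at
          \<open>y\<close> is real.\<close>
        have "fconj f 0 \<le> ereal 0" using conj[of 0] by simp
        then have "fconj (fconj f) y \<noteq> -\<infinity>"
          by (intro fconj_not_MInfty[of _ 0]) auto
        then obtain m where m: "fconj (fconj f) y = ereal m"
          using y by (cases "fconj (fconj f) y") (auto simp: edom_def)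
        have bound: "t * (x \<bullet> y - b) \<le> m" if "0 \<le> t" for t
        proof -
          have "ereal (t * (x \<bullet> y - b)) = ereal (y \<bullet> (t *\<^sub>R x)) - ereal (t * b)"
            by (simp add: algebra_simps inner_commute)
          also have "\<dots> \<le> ereal (y \<bullet> (t *\<^sub>R x)) - fconj f (t *\<^sub>R x)"
            by (intro ereal_minus_mono conj that) simp
          also have "\<dots> \<le> ereal m" using Fenchel_Young[of y "t *\<^sub>R x" "fconj f"] m by simp
          finally show ?thesis by simp
        qed
        have "x \<bullet> y \<le> b"
        proof (rule ccontr)
          assume "\<not> x \<bullet> y \<le> b"
          then have d: "0 < x \<bullet> y - b" by simp
          \<comment> \<open>Nonnegativity of \<open>m\<close> makes
            \<open>(m + 1) / (x \<bullet> y - b)\<close> an admissible \<open>t\<close>, for which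
            the bound reads \<open>m + 1 \<le> m\<close>.\<close>
          have "0 \<le> m" using bound[of 0] by simp
          then show False using bound[of "(m + 1) / (x \<bullet> y - b)"] d by simp
        qed
        then show ?thesis using real by simp
      next
        case MInf
        moreover have "ereal (x \<bullet> z0) \<le> ?S"
          unfolding eq using z0 by (intro SUP_upper) (simp add: edom_def)
        ultimately show ?thesis by simp
      qed simp
    qed
    \<comment> \<open>The easy direction: \<open>f\<^sup>*\<^sup>*\<close> lies below
      \<open>f\<close>, so its domain is at least as large.\<close>
    have "edom f \<subseteq> edom (fconj (fconj f))"
    proof
      fix z assume z: "z \<in> edom f"
      have "fconj (fconj f) z \<le> f z"
        unfolding fconj_def[of "fconj f"]
      proof (rule SUP_least)
        fix y
        show "ereal (z \<bullet> y) - fconj f y \<le> f z"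
          using Fenchel_Young[of y z f] f[of z] z
          by (cases "f z"; cases "fconj f y") (auto simp: inner_commute edom_def)
      qed
      with z show "z \<in> edom (fconj (fconj f))" by (auto simp: edom_def)
    qed
    then show "?S \<le> (SUP z\<in>edom (fconj (fconj f)). ereal (x \<bullet> z))"
      unfolding eq by (intro SUP_subset_mono) auto
  qed
  then show ?thesis by (simp add: perspective_def True)
qed

section \<open>Part (i): the dual formula and convexity\<close>

text \<open>Restricting \<open>z\<close> and \<open>\<gamma>\<close> to the two domains makes the
  cost and the conjugate of \<open>L\<close> real there. Each can thus be moved across an
  inequality, and the suprema are exchanged as two inequalities without any difference of
  infinities.\<close>

lemma ell_eq_SUP_perspective:
  fixes c :: "'a::real_inner \<Rightarrow> 'a \<Rightarrow> ereal"
  assumes L: "proper_fun L" "econvex_on UNIV L" "lsc_fun L"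
    and c: "\<And>z. 0 \<le> c z zh" "c z0 zh < \<infinity>" and l: "0 \<le> l"
  shows "ell L c \<theta> l zh =
    (SUP \<gamma>\<in>edom (fconj L). perspective (fconj (\<lambda>z. c z zh)) l (\<gamma> *\<^sub>R \<theta>) - fconj L \<gamma>)"
    (is "_ = ?R")
proof -
  let ?P = "\<lambda>\<gamma>. perspective (fconj (\<lambda>z. c z zh)) l (\<gamma> *\<^sub>R \<theta>)"
  have P: "?P \<gamma> = (SUP z\<in>edom (\<lambda>z. c z zh). ereal ((\<gamma> *\<^sub>R \<theta>) \<bullet> z) - ereal l * c z zh)" for \<gamma>
    by (rule perspective_fconj[of "\<lambda>z. c z zh", OF c l])
  have conj: "\<exists>m. fconj L \<gamma> = ereal m" if "\<gamma> \<in> edom (fconj L)" for \<gamma>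
  proof -
    obtain x where "L x \<noteq> \<infinity>" using L(1) by (auto simp: proper_fun_def)
    from fconj_not_MInfty[of L, OF this, of \<gamma>] that show ?thesis
      by (cases "fconj L \<gamma>") (auto simp: edom_def)
  qed
  have cost: "\<exists>r. c z zh = ereal r" if "z \<in> edom (\<lambda>z. c z zh)" for z
    using that c(1)[of z] by (cases "c z zh") (auto simp: edom_def)
  show ?thesis
  proof (rule antisym)
    show "ell L c \<theta> l zh \<le> ?R"
      unfolding ell_def
    proof (rule SUP_least)
      fix z assume z: "z \<in> edom (\<lambda>z. c z zh)"
      then obtain r where r: "c z zh = ereal r" using cost by blast
      have "L (\<theta> \<bullet> z) \<le> (SUP \<gamma>\<in>edom (fconj L). ereal (\<gamma> \<bullet> (\<theta> \<bullet> z)) - fconj L \<gamma>)"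
        by (rule Fenchel_Moreau_le[OF L])
      \<comment> \<open>The real number \<open>l * r\<close> is put on the right so that the
        supremum over \<open>\<gamma>\<close> can be bounded term by term.\<close>
      also have "\<dots> \<le> ?R + ereal (l * r)"
      proof (rule SUP_least)
        fix \<gamma> assume \<gamma>: "\<gamma> \<in> edom (fconj L)"
        then obtain m where m: "fconj L \<gamma> = ereal m" using conj by blast
        have "ereal ((\<gamma> *\<^sub>R \<theta>) \<bullet> z) - ereal l * c z zh \<le> ?P \<gamma>"
          unfolding P using z by (rule SUP_upper)
        moreover have "?P \<gamma> - fconj L \<gamma> \<le> ?R" using \<gamma> by (rule SUP_upper)
        ultimately show "ereal (\<gamma> \<bullet> (\<theta> \<bullet> z)) - fconj L \<gamma> \<le> ?R + ereal (l * r)"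
          using r m by (cases "?P \<gamma>"; cases ?R) auto
      qed
      finally show "L (\<theta> \<bullet> z) - ereal l * c z zh \<le> ?R"
        by (simp add: r ereal_minus_le)
    qed
    show "?R \<le> ell L c \<theta> l zh"
    proof (rule SUP_least)
      fix \<gamma> assume "\<gamma> \<in> edom (fconj L)"
      then obtain m where m: "fconj L \<gamma> = ereal m" using conj by blast
      \<comment> \<open>Now \<open>m\<close> is the real number moved across; Fenchel-Young bounds
        each term of the supremum over \<open>z\<close>.\<close>
      have "?P \<gamma> \<le> ell L c \<theta> l zh + ereal m"
        unfolding P
      proof (rule SUP_least)
        fix z assume z: "z \<in> edom (\<lambda>z. c z zh)"
        then obtain r where r: "c z zh = ereal r" using cost by blast
        have "L (\<theta> \<bullet> z) - ereal l * c z zh \<le> ell L c \<theta> l zh"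
          unfolding ell_def using z by (rule SUP_upper)
        moreover have "ereal (\<gamma> * (\<theta> \<bullet> z)) - L (\<theta> \<bullet> z) \<le> ereal m"
          using Fenchel_Young[of \<gamma> "\<theta> \<bullet> z" L] m by simp
        ultimately show "ereal ((\<gamma> *\<^sub>R \<theta>) \<bullet> z) - ereal l * c z zh \<le> ell L c \<theta> l zh + ereal m"
          using r by (cases "L (\<theta> \<bullet> z)"; cases "ell L c \<theta> l zh") auto
      qed
      then show "?P \<gamma> - fconj L \<gamma> \<le> ell L c \<theta> l zh"
        by (simp add: m ereal_minus_le)
    qed
  qed
qed

text \<open>For fixed \<open>z\<close> in the domain of the cost the term is \<open>L\<close>
  composed with a linear map of \<open>\<theta>\<close>, minus a multiple of \<open>l\<close>, hence
  jointly convex; suprema preserve this.\<close>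

lemma econvex_on_ell:
  fixes c :: "'a::real_inner \<Rightarrow> 'a \<Rightarrow> ereal"
  assumes L: "\<And>x. L x \<noteq> -\<infinity>" "econvex_on UNIV L" and c: "\<And>z. 0 \<le> c z zh"
  shows "econvex_on (UNIV \<times> {0..}) (\<lambda>(\<theta>, l). ell L c \<theta> l zh)"
proof -
  have "ell L c (u *\<^sub>R \<theta> + v *\<^sub>R \<theta>') (u * l + v * l') zh
      \<le> ereal u * ell L c \<theta> l zh + ereal v * ell L c \<theta>' l' zh"
    if l: "0 \<le> l" "0 \<le> l'" and uv: "0 \<le> u" "0 \<le> v" "u + v = 1" for \<theta> \<theta>' l l' u v
    unfolding ell_def[of L c "u *\<^sub>R \<theta> + v *\<^sub>R \<theta>'"]
  proof (rule SUP_least)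
    fix z assume z: "z \<in> edom (\<lambda>z. c z zh)"
    then obtain r where r: "c z zh = ereal r"
      using c[of z] by (cases "c z zh") (auto simp: edom_def)
    have le: "L (\<theta> \<bullet> z) - ereal l * c z zh \<le> ell L c \<theta> l zh" for \<theta> l
      unfolding ell_def using z by (rule SUP_upper)
    have "L ((u *\<^sub>R \<theta> + v *\<^sub>R \<theta>') \<bullet> z) = L (u *\<^sub>R (\<theta> \<bullet> z) + v *\<^sub>R (\<theta>' \<bullet> z))"
      by (simp add: inner_add_left)
    also have "\<dots> \<le> ereal u * L (\<theta> \<bullet> z) + ereal v * L (\<theta>' \<bullet> z)"
      using L(2) uv by (simp add: econvex_on_def)
    finally have "L ((u *\<^sub>R \<theta> + v *\<^sub>R \<theta>') \<bullet> z) - ereal (u * l + v * l') * c z zh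
        \<le> ereal u * L (\<theta> \<bullet> z) + ereal v * L (\<theta>' \<bullet> z) - ereal (u * l + v * l') * c z zh"
      by (intro ereal_minus_mono) auto
    \<comment> \<open>The regrouping is legitimate because the cost is the real \<open>r\<close> and
      \<open>L\<close> avoids \<open>-\<infinity>\<close>. Zero weights are split off since
      \<open>0 * \<infinity> = 0\<close>.\<close>
    also have "\<dots> = ereal u * (L (\<theta> \<bullet> z) - ereal l * c z zh)
        + ereal v * (L (\<theta>' \<bullet> z) - ereal l' * c z zh)"
      using r uv(1,2) L(1)[of "\<theta> \<bullet> z"] L(1)[of "\<theta>' \<bullet> z"]
      by (cases "L (\<theta> \<bullet> z)"; cases "L (\<theta>' \<bullet> z)"; cases "u = 0"; cases "v = 0")
         (auto simp: algebra_simps)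
    also have "\<dots> \<le> ereal u * ell L c \<theta> l zh + ereal v * ell L c \<theta>' l' zh"
      using uv by (intro add_mono ereal_mult_left_mono le) auto
    finally show "L ((u *\<^sub>R \<theta> + v *\<^sub>R \<theta>') \<bullet> z) - ereal (u * l + v * l') * c z zh
        \<le> ereal u * ell L c \<theta> l zh + ereal v * ell L c \<theta>' l' zh" .
  qed
  then show ?thesis
    by (auto simp: econvex_on_def intro!: convex_Times)
qed

section \<open>Abstract norms and their dual norms\<close>

lemma is_norm_zero: "is_norm N \<Longrightarrow> N 0 = 0"
  unfolding is_norm_def by blast

lemma is_norm_nonneg:
  assumes "is_norm N"
  shows "0 \<le> N x"
proof -
  have "N 0 = 0" using assms by (rule is_norm_zero)
  moreover have "N (x + (-1) *\<^sub>R x) \<le> N x + N ((-1) *\<^sub>R x)"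
    using assms unfolding is_norm_def by blast
  moreover have "N ((-1) *\<^sub>R x) = \<bar>-1\<bar> * N x"
    using assms unfolding is_norm_def by blast
  ultimately show ?thesis by simp
qed

text \<open>Expanding \<open>x\<close> in the standard basis bounds \<open>N\<close> by a multiple
  of the Euclidean norm; the reverse triangle inequality turns this bound into a Lipschitz
  estimate.\<close>

lemma is_norm_continuous_on:
  fixes N :: "'a::euclidean_space \<Rightarrow> real"
  assumes "is_norm N"
  shows "continuous_on A N"
proof -
  have tri: "N (x + y) \<le> N x + N y" and hom: "N (a *\<^sub>R x) = \<bar>a\<bar> * N x" for a x y
    using assms by (auto simp: is_norm_def)
  have nn: "0 \<le> N x" for x by (rule is_norm_nonneg[OF assms])
  define C where "C = (\<Sum>b\<in>Basis. N b)"
  have sum: "N (\<Sum>b\<in>S. g b) \<le> (\<Sum>b\<in>S. N (g b))" if "finite S" for S and g :: "'a \<Rightarrow> 'a"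
    using that
  proof induction
    case empty
    show ?case by (simp add: is_norm_zero[OF assms])
  next
    case (insert b S)
    then show ?case using tri[of "g b" "sum g S"] by simp
  qed
  have le: "N x \<le> C * norm x" for x
  proof -
    have "N x = N (\<Sum>b\<in>Basis. (x \<bullet> b) *\<^sub>R b)" by (simp add: euclidean_representation)
    also have "\<dots> \<le> (\<Sum>b\<in>Basis. N ((x \<bullet> b) *\<^sub>R b))" by (rule sum) simp
    also have "\<dots> \<le> (\<Sum>b\<in>Basis. norm x * N b)"
      unfolding hom using nn by (intro sum_mono mult_right_mono Basis_le_norm) auto
    also have "\<dots> = C * norm x" by (simp add: C_def sum_distrib_left mult.commute)
    finally show ?thesis .
  qed
  have "C-lipschitz_on A N"
  proof (rule lipschitz_onI)
    fix x y
    have "N x \<le> N y + N (x - y)" using tri[of y "x - y"] by simp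
    moreover have "N y \<le> N x + N (y - x)" using tri[of x "y - x"] by simp
    ultimately show "dist (N x) (N y) \<le> C * dist x y"
      using le[of "x - y"] le[of "y - x"] by (simp add: dist_norm norm_minus_commute)
    show "0 \<le> C" by (simp add: C_def sum_nonneg nn)
  qed
  then show ?thesis by (rule lipschitz_on_continuous_on)
qed

text \<open>By continuity \<open>N\<close> attains a minimum on the Euclidean unit sphere, positive
  by definiteness; homogeneity then bounds the ball by the reciprocal of that minimum.\<close>

lemma is_norm_compact_unit_ball:
  fixes N :: "'a::euclidean_space \<Rightarrow> real"
  assumes "is_norm N"
  shows "compact {x. N x \<le> 1}"
proof -
  have cont: "continuous_on A N" for A by (rule is_norm_continuous_on[OF assms])
  have hom: "N (a *\<^sub>R x) = \<bar>a\<bar> * N x" and zero: "N x = 0 \<longleftrightarrow> x = 0" for a x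
    using assms by (auto simp: is_norm_def)
  obtain s where s: "s \<in> sphere 0 1" "\<And>x. x \<in> sphere 0 1 \<Longrightarrow> N s \<le> N x"
    using continuous_attains_inf[OF _ _ cont, of "sphere 0 1"] by auto
  have Ns: "0 < N s"
    using s(1) zero[of s] is_norm_nonneg[OF assms, of s] by force
  have "norm x \<le> 1 / N s" if "N x \<le> 1" for x
  proof (cases "x = 0")
    case False
    have "N s \<le> N (x /\<^sub>R norm x)" using False by (intro s) simp
    also have "\<dots> = N x / norm x" by (simp add: hom divide_inverse mult.commute)
    finally have "N s * norm x \<le> N x" using False by (simp add: field_simps)
    then show ?thesis using that Ns by (simp add: field_simps)
  qed (use Ns in simp)
  then have "bounded {x. N x \<le> 1}" by (auto simp: bounded_iff)
  moreover have "closed {x. N x \<le> 1}"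
    using closed_Collect_le[OF cont continuous_on_const] by blast
  ultimately show ?thesis by (simp add: compact_eq_bounded_closed)
qed

text \<open>The dual norm is a real supremum, informative only over a nonempty set of values bounded
  above. Compactness of the unit ball provides the bound and a maximizer \<open>u\<close> at
  once.\<close>

lemma dual_norm_attained:
  fixes N :: "'a::euclidean_space \<Rightarrow> real"
  assumes "is_norm N"
  obtains u where "N u \<le> 1" "u \<bullet> y = dual_norm N y" "\<And>x. N x \<le> 1 \<Longrightarrow> x \<bullet> y \<le> dual_norm N y"
proof -
  have "N 0 = 0" using assms by (rule is_norm_zero)
  then have ne: "{x. N x \<le> 1} \<noteq> {}" by (metis (mono_tags) empty_Collect_eq zero_le_one)
  have cont: "continuous_on {x. N x \<le> 1} (\<lambda>x. x \<bullet> y)" by (intro continuous_intros)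
  obtain u where u: "N u \<le> 1" "\<And>x. N x \<le> 1 \<Longrightarrow> x \<bullet> y \<le> u \<bullet> y"
    using continuous_attains_sup[OF is_norm_compact_unit_ball[OF assms] ne cont] by auto
  have "dual_norm N y = u \<bullet> y"
    unfolding dual_norm_def using u by (intro cSup_eq_maximum) auto
  with u that show ?thesis by metis
qed

text \<open>Test the supremum at \<open>x / N x\<close> and at its negative; the factor
  \<open>a\<close> stands for the sign.\<close>

lemma dual_norm_Cauchy_Schwarz:
  fixes N :: "'a::euclidean_space \<Rightarrow> real"
  assumes "is_norm N"
  shows "\<bar>x \<bullet> y\<bar> \<le> dual_norm N y * N x"
proof (cases "x = 0")
  case True
  then show ?thesis by (simp add: is_norm_zero[OF assms])
next
  case False
  have hom: "N (a *\<^sub>R x) = \<bar>a\<bar> * N x" and zero: "N x = 0 \<longleftrightarrow> x = 0" for a x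
    using assms by (auto simp: is_norm_def)
  have Nx: "0 < N x" using is_norm_nonneg[OF assms, of x] zero[of x] False by simp
  have le: "a * (x \<bullet> y) \<le> dual_norm N y * N x" if "\<bar>a\<bar> = 1" for a
  proof -
    have "N ((a / N x) *\<^sub>R x) \<le> 1" using Nx that by (simp add: hom)
    then have "((a / N x) *\<^sub>R x) \<bullet> y \<le> dual_norm N y"
      using dual_norm_attained[OF assms] by metis
    then show ?thesis using Nx by (simp add: field_simps)
  qed
  show ?thesis using le[of 1] le[of "-1"] by simp
qed

section \<open>Part (ii): reduction to one dimension\<close>

text \<open>Each \<open>z\<close> is matched by a \<open>\<gamma>\<close> with the same argument of
  \<open>L\<close> and no larger penalty, by the Cauchy-Schwarz inequality; each
  \<open>\<gamma>\<close> is matched likewise by a \<open>z\<close> on the line through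
  \<open>zh\<close> in a maximizing direction.\<close>

lemma ell_norm_power:
  fixes c :: "'a::euclidean_space \<Rightarrow> 'a \<Rightarrow> ereal"
  assumes N: "is_norm N" and p: "0 \<le> p" and c: "\<And>z. c z zh = ereal (N (z - zh) powr p)"
    and l: "0 \<le> l"
  shows "ell L c \<theta> l zh =
    (SUP \<gamma>. L (\<theta> \<bullet> zh + \<gamma> * dual_norm N \<theta>) - ereal (l * \<bar>\<gamma>\<bar> powr p))" (is "_ = ?R")
proof -
  have dom: "edom (\<lambda>z. c z zh) = UNIV" by (simp add: edom_def c)
  have ell: "ell L c \<theta> l zh = (SUP z. L (\<theta> \<bullet> z) - ereal (l * N (z - zh) powr p))"
    unfolding ell_def dom by (simp add: c)
  show ?thesis
  proof (rule antisym)
    show "ell L c \<theta> l zh \<le> ?R"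
      unfolding ell
    proof (rule SUP_least)
      fix z
      define w where "w = z - zh"
      define \<gamma> where "\<gamma> = (w \<bullet> \<theta>) / dual_norm N \<theta>"
      have CS: "\<bar>w \<bullet> \<theta>\<bar> \<le> dual_norm N \<theta> * N w" by (rule dual_norm_Cauchy_Schwarz[OF N])
      have nn: "0 \<le> N w" by (rule is_norm_nonneg[OF N])
      have "0 \<le> dual_norm N \<theta>"
        using dual_norm_attained[OF N, of \<theta>] is_norm_zero[OF N]
        by (metis inner_zero_left zero_le_one)
      \<comment> \<open>If the dual norm vanishes, then \<open>\<gamma> = 0\<close> by division by zero, which is the right choice.\<close>
      then have "\<bar>\<gamma>\<bar> \<le> N w" "\<gamma> * dual_norm N \<theta> = w \<bullet> \<theta>"
        using CS nn by (cases "dual_norm N \<theta> = 0"; simp add: \<gamma>_def field_simps)+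
      then have "l * \<bar>\<gamma>\<bar> powr p \<le> l * N w powr p" and "\<theta> \<bullet> zh + \<gamma> * dual_norm N \<theta> = \<theta> \<bullet> z"
        using p l by (auto simp: w_def inner_diff_left inner_diff_right inner_commute
          intro!: mult_left_mono powr_mono2)
      then have "L (\<theta> \<bullet> z) - ereal (l * N w powr p)
          \<le> L (\<theta> \<bullet> zh + \<gamma> * dual_norm N \<theta>) - ereal (l * \<bar>\<gamma>\<bar> powr p)"
        by (intro ereal_minus_mono) auto
      also have "\<dots> \<le> ?R" by (rule SUP_upper) simp
      finally show "L (\<theta> \<bullet> z) - ereal (l * N (z - zh) powr p) \<le> ?R" by (simp add: w_def)
    qed
    show "?R \<le> ell L c \<theta> l zh"
    proof (rule SUP_least)
      fix \<gamma>
      \<comment> \<open>The point \<open>zh + \<gamma> *\<^sub>R u\<close> shifts the inner product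
        by exactly \<open>\<gamma> * dual_norm N \<theta>\<close> and has distance at most
        \<open>\<bar>\<gamma>\<bar>\<close> from \<open>zh\<close>, whatever the sign of
        \<open>\<gamma>\<close>.\<close>
      obtain u where u: "N u \<le> 1" "u \<bullet> \<theta> = dual_norm N \<theta>"
        using dual_norm_attained[OF N] by metis
      have "N (\<gamma> *\<^sub>R u) = \<bar>\<gamma>\<bar> * N u" using N by (simp add: is_norm_def)
      also have "\<dots> \<le> \<bar>\<gamma>\<bar>" using u(1) by (simp add: mult_left_le)
      finally have "l * N (\<gamma> *\<^sub>R u) powr p \<le> l * \<bar>\<gamma>\<bar> powr p"
        using p l is_norm_nonneg[OF N] by (intro mult_left_mono powr_mono2) auto
      then have "L (\<theta> \<bullet> zh + \<gamma> * dual_norm N \<theta>) - ereal (l * \<bar>\<gamma>\<bar> powr p)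
          \<le> L (\<theta> \<bullet> (zh + \<gamma> *\<^sub>R u)) - ereal (l * N ((zh + \<gamma> *\<^sub>R u) - zh) powr p)"
        using u(2) by (intro ereal_minus_mono) (auto simp: inner_add_right inner_commute)
      also have "\<dots> \<le> ell L c \<theta> l zh"
        unfolding ell by (rule SUP_upper) simp
      finally show "L (\<theta> \<bullet> zh + \<gamma> * dual_norm N \<theta>) - ereal (l * \<bar>\<gamma>\<bar> powr p) \<le> ell L c \<theta> l zh" .
    qed
  qed
qed

theorem theorem4:
  fixes L :: "real \<Rightarrow> ereal"
    and c :: "real ^ 'n \<Rightarrow> real ^ 'n \<Rightarrow> ereal"
  assumes "\<And>x. L x \<noteq> -\<infinity>"
    and "\<And>z zh. 0 \<le> c z zh"
    and "\<And>z zh. c z zh = 0 \<longleftrightarrow> z = zh"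
  shows "(proper_fun L \<and> econvex_on UNIV L \<and> lsc_fun L \<and>
          proper_fun (\<lambda>(z, zh). c z zh) \<and> lsc_fun (\<lambda>(z, zh). c z zh) \<longrightarrow>
            (\<forall>\<theta> l zh. 0 \<le> l \<longrightarrow>
               ell L c \<theta> l zh =
                 (SUP \<gamma>\<in>edom (fconj L).
                    perspective (fconj (\<lambda>z. c z zh)) l (\<gamma> *\<^sub>R \<theta>) - fconj L \<gamma>)) \<and>
            (\<forall>zh. econvex_on (UNIV \<times> {0..}) (\<lambda>(\<theta>, l). ell L c \<theta> l zh))) \<and>
         (\<forall>N p. is_norm N \<and> 1 \<le> p \<and> (\<forall>z zh. c z zh = ereal (N (z - zh) powr p)) \<longrightarrow>
            (\<forall>\<theta> l zh. 0 \<le> l \<longrightarrow>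
               ell L c \<theta> l zh =
                 (SUP \<gamma>. L (\<theta> \<bullet> zh + \<gamma> * dual_norm N \<theta>) - ereal (l * \<bar>\<gamma>\<bar> powr p))))"
proof (intro conjI impI allI; (elim conjE)?)
  fix \<theta> :: "real ^ 'n" and l :: real and zh
  assume "proper_fun L" "econvex_on UNIV L" "lsc_fun L" "0 \<le> l"
  \<comment> \<open>The vanishing cost on the diagonal supplies a point in the domain of the cost
    for every \<open>zh\<close>.\<close>
  moreover have "c zh zh < \<infinity>" using assms(3)[of zh zh] by simp
  ultimately show "ell L c \<theta> l zh =
      (SUP \<gamma>\<in>edom (fconj L). perspective (fconj (\<lambda>z. c z zh)) l (\<gamma> *\<^sub>R \<theta>) - fconj L \<gamma>)"
    using assms(2) by (intro ell_eq_SUP_perspective) auto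
next
  fix zh
  assume "econvex_on UNIV L"
  then show "econvex_on (UNIV \<times> {0..}) (\<lambda>(\<theta>, l). ell L c \<theta> l zh)"
    using assms by (intro econvex_on_ell) auto
next
  fix N p zh and l :: real and \<theta> :: "real ^ 'n"
  assume "is_norm N" "1 \<le> p" "\<forall>z zh. c z zh = ereal (N (z - zh) powr p)" "0 \<le> l"
  then show "ell L c \<theta> l zh =
      (SUP \<gamma>. L (\<theta> \<bullet> zh + \<gamma> * dual_norm N \<theta>) - ereal (l * \<bar>\<gamma>\<bar> powr p))"
    by (intro ell_norm_power) auto
qed

end
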